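(* For every formula $A$ of the language of classical propositional logic (i.e., built from $\bot$ and atomic propositions by $\to$, without any subformula of the form $t:B$), $\vdash_{\mathsf{SE}} A$ if and only if $\vdash_{\mathsf{CL}} A$.
   Context: Syntax of $\mathsf{SE}$. There are countably infinite sets of justification constants $\mathsf{JConst}=\{0,1,c_1,c_2,\dots\}$ and justification variables $\mathsf{JVar}$. Terms: constants, variables, and $s\cdot t$, $s+t$ for terms $s,t$. Formulas: $\bot$, atomic propositions $P\in\mathsf{Prop}$, $A\to B$, and $t:A$; $\neg,\wedge,\vee,\leftrightarrow$ are abbreviations. $A[w/t]$ is simultaneous replacement of the variable $w$ by term $t$. Axioms of $\mathsf{SE}$ (for arbitrary formulas $A,B$ and variables $w,x,y,z$): (CL) propositional tautologies; (j) $x:(A\to B)\to(y:A\to x\cdot y:B)$; (j+) $x:A\wedge y:A\to(x+y):A$; (a+) $A[w/(x+y)+z]\to A[w/x+(y+z)]$; (c+) $A[w/x+y]\to A[w/y+x]$; (0+) $A[w/x+0]\leftrightarrow A[w/x]$; (am) $A[w/(x\cdot y)\cdot z]\leftrightarrow A[w/x\cdot(y\cdot z)]$; (a0) $A[w/x\cdot 0]\leftrightarrow A[w/0]$, $A[w/0\cdot x]\leftrightarrow A[w/0]$; (a1) $A[w/x\cdot 1]\leftrightarrow A[w/x]$, $A[w/1\cdot x]\leftrightarrow A[w/x]$; (dl) $A[w/x\cdot(y+z)]\leftrightarrow A[w/x\cdot y+x\cdot z]$; (dr) $A[w/(y+z)\cdot x]\leftrightarrow A[w/y\cdot x+z\cdot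 x]$. Rules: modus ponens and (jv): from $A$ infer $A[x/t]$. $\vdash_{\mathsf{SE}}F$ means $F$ is derivable from the axioms by these rules. $\vdash_{\mathsf{CL}}$ denotes derivability in classical propositional logic. *)

theory Defs
  imports Main
begin

text \<open>\<open>C i\<close> stands for the constant \<open>c\<close> with index \<open>i + 1\<close>.\<close>

datatype jconst = Zero | One | C nat

datatype jterm =
    Const jconst
  | Var nat
  | App jterm jterm (infixl "\<cdot>" 70)
  | Sum jterm jterm (infixl "\<oplus>" 65)

abbreviation jzero :: jterm ("\<zero>") where "\<zero> \<equiv> Const Zero"
abbreviation jone :: jterm ("\<one>") where "\<one> \<equiv> Const One"

text \<open>The type parameter \<open>'p\<close> is the set of atomic propositions.\<close>

datatype 'p fm =
    Falsum
  | Atom 'p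
  | Imp "'p fm" "'p fm" (infixr "\<^bold>\<rightarrow>" 25)
  | Just jterm "'p fm" (infixr "\<^bold>:" 55)

abbreviation Neg :: "'p fm \<Rightarrow> 'p fm" ("\<^bold>\<not> _" [40] 40) where
  "\<^bold>\<not> A \<equiv> (A \<^bold>\<rightarrow> Falsum)"

abbreviation Conj :: "'p fm \<Rightarrow> 'p fm \<Rightarrow> 'p fm" (infixr "\<^bold>\<and>" 35) where
  "A \<^bold>\<and> B \<equiv> \<^bold>\<not> (A \<^bold>\<rightarrow> \<^bold>\<not> B)"

abbreviation (input) Disj :: "'p fm \<Rightarrow> 'p fm \<Rightarrow> 'p fm" (infixr "\<^bold>\<or>" 30) where
  "A \<^bold>\<or> B \<equiv> (\<^bold>\<not> A \<^bold>\<rightarrow> B)"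

abbreviation Iff :: "'p fm \<Rightarrow> 'p fm \<Rightarrow> 'p fm" (infix "\<^bold>\<leftrightarrow>" 25) where
  "A \<^bold>\<leftrightarrow> B \<equiv> (A \<^bold>\<rightarrow> B) \<^bold>\<and> (B \<^bold>\<rightarrow> A)"

primrec tsubst :: "jterm \<Rightarrow> nat \<Rightarrow> jterm \<Rightarrow> jterm" where
  "tsubst (Const c) w t = Const c"
| "tsubst (Var x) w t = (if x = w then t else Var x)"
| "tsubst (r \<cdot> s) w t = tsubst r w t \<cdot> tsubst s w t"
| "tsubst (r \<oplus> s) w t = tsubst r w t \<oplus> tsubst s w t"

primrec fsubst :: "'p fm \<Rightarrow> nat \<Rightarrow> jterm \<Rightarrow> 'p fm" ("_\<langle>_'/_\<rangle>" [1000, 0, 0] 1000) where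
  "fsubst Falsum w t = Falsum"
| "fsubst (Atom P) w t = Atom P"
| "fsubst (A \<^bold>\<rightarrow> B) w t = (fsubst A w t \<^bold>\<rightarrow> fsubst B w t)"
| "fsubst (s \<^bold>: A) w t = (tsubst s w t \<^bold>: fsubst A w t)"

text \<open>
  Tautologies of the full language: a valuation assigns arbitrary truth values to
  the propositionally indecomposable formulas, i.e. to atoms and to formulas \<open>t \<^bold>: A\<close>.
\<close>

primrec eval :: "('p fm \<Rightarrow> bool) \<Rightarrow> 'p fm \<Rightarrow> bool" where
  "eval v Falsum \<longleftrightarrow> False"
| "eval v (Atom P) \<longleftrightarrow> v (Atom P)"
| "eval v (A \<^bold>\<rightarrow> B) \<longleftrightarrow> (eval v A \<longrightarrow> eval v B)"
| "eval v (t \<^bold>: A) \<longleftrightarrow> v (t \<^bold>: A)"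

definition tautology :: "'p fm \<Rightarrow> bool" where
  "tautology A \<longleftrightarrow> (\<forall>v. eval v A)"

inductive se_axiom :: "'p fm \<Rightarrow> bool" where
  CL: "tautology A \<Longrightarrow> se_axiom A"
| j: "se_axiom (Var x \<^bold>: (A \<^bold>\<rightarrow> B) \<^bold>\<rightarrow> (Var y \<^bold>: A \<^bold>\<rightarrow> (Var x \<cdot> Var y) \<^bold>: B))"
| j_plus: "se_axiom ((Var x \<^bold>: A \<^bold>\<and> Var y \<^bold>: A) \<^bold>\<rightarrow> (Var x \<oplus> Var y) \<^bold>: A)"
| a_plus: "se_axiom (A\<langle>w/(Var x \<oplus> Var y) \<oplus> Var z\<rangle> \<^bold>\<rightarrow> A\<langle>w/Var x \<oplus> (Var y \<oplus> Var z)\<rangle>)"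
| c_plus: "se_axiom (A\<langle>w/Var x \<oplus> Var y\<rangle> \<^bold>\<rightarrow> A\<langle>w/Var y \<oplus> Var x\<rangle>)"
| zero_plus: "se_axiom (A\<langle>w/Var x \<oplus> \<zero>\<rangle> \<^bold>\<leftrightarrow> A\<langle>w/Var x\<rangle>)"
| am: "se_axiom (A\<langle>w/(Var x \<cdot> Var y) \<cdot> Var z\<rangle> \<^bold>\<leftrightarrow> A\<langle>w/Var x \<cdot> (Var y \<cdot> Var z)\<rangle>)"
| a0_right: "se_axiom (A\<langle>w/Var x \<cdot> \<zero>\<rangle> \<^bold>\<leftrightarrow> A\<langle>w/\<zero>\<rangle>)"
| a0_left: "se_axiom (A\<langle>w/\<zero> \<cdot> Var x\<rangle> \<^bold>\<leftrightarrow> A\<langle>w/\<zero>\<rangle>)"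
| a1_right: "se_axiom (A\<langle>w/Var x \<cdot> \<one>\<rangle> \<^bold>\<leftrightarrow> A\<langle>w/Var x\<rangle>)"
| a1_left: "se_axiom (A\<langle>w/\<one> \<cdot> Var x\<rangle> \<^bold>\<leftrightarrow> A\<langle>w/Var x\<rangle>)"
| dl: "se_axiom (A\<langle>w/Var x \<cdot> (Var y \<oplus> Var z)\<rangle> \<^bold>\<leftrightarrow> A\<langle>w/Var x \<cdot> Var y \<oplus> Var x \<cdot> Var z\<rangle>)"
| dr: "se_axiom (A\<langle>w/(Var y \<oplus> Var z) \<cdot> Var x\<rangle> \<^bold>\<leftrightarrow> A\<langle>w/Var y \<cdot> Var x \<oplus> Var z \<cdot> Var x\<rangle>)"

inductive se_derivable :: "'p fm \<Rightarrow> bool" ("\<turnstile>\<^sub>S\<^sub>E _" [20] 20) where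
  ax: "se_axiom A \<Longrightarrow> \<turnstile>\<^sub>S\<^sub>E A"
| mp: "(\<turnstile>\<^sub>S\<^sub>E A \<^bold>\<rightarrow> B) \<Longrightarrow> (\<turnstile>\<^sub>S\<^sub>E A) \<Longrightarrow> \<turnstile>\<^sub>S\<^sub>E B"
| jv: "(\<turnstile>\<^sub>S\<^sub>E A) \<Longrightarrow> \<turnstile>\<^sub>S\<^sub>E A\<langle>x/t\<rangle>"

primrec classical :: "'p fm \<Rightarrow> bool" where
  "classical Falsum \<longleftrightarrow> True"
| "classical (Atom P) \<longleftrightarrow> True"
| "classical (A \<^bold>\<rightarrow> B) \<longleftrightarrow> classical A \<and> classical B"
| "classical (t \<^bold>: A) \<longleftrightarrow> False"

text \<open>
  A standard Hilbert calculus for classical propositional logic in \<open>\<bottom>, \<rightarrow>\<close>; every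
  formula occurring in a derivation belongs to the classical language.
\<close>

inductive cl_derivable :: "'p fm \<Rightarrow> bool" ("\<turnstile>\<^sub>C\<^sub>L _" [20] 20) where
  K: "classical A \<Longrightarrow> classical B \<Longrightarrow> \<turnstile>\<^sub>C\<^sub>L A \<^bold>\<rightarrow> (B \<^bold>\<rightarrow> A)"
| S: "classical A \<Longrightarrow> classical B \<Longrightarrow> classical D \<Longrightarrow>
      \<turnstile>\<^sub>C\<^sub>L (A \<^bold>\<rightarrow> (B \<^bold>\<rightarrow> D)) \<^bold>\<rightarrow> ((A \<^bold>\<rightarrow> B) \<^bold>\<rightarrow> (A \<^bold>\<rightarrow> D))"
| DN: "classical A \<Longrightarrow> \<turnstile>\<^sub>C\<^sub>L \<^bold>\<not> \<^bold>\<not> A \<^bold>\<rightarrow> A"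
| MP: "(\<turnstile>\<^sub>C\<^sub>L A \<^bold>\<rightarrow> B) \<Longrightarrow> (\<turnstile>\<^sub>C\<^sub>L A) \<Longrightarrow> \<turnstile>\<^sub>C\<^sub>L B"

end

theory Submission imports Defs begin

text \<open>
  The forgetful projection deletes all terms; it turns every axiom of \<open>SE\<close> into a tautology, is
  blind to term substitution, and fixes classical formulas. Hence a classical theorem of \<open>SE\<close> is a
  tautology, and is derivable in \<open>CL\<close> by Kalmar's completeness argument: a formula or its negation
  follows from the literals describing a valuation, and the literals are then discharged one atom
  at a time.
\<close>

primrec forget :: "'p fm \<Rightarrow> 'p fm" where
  "forget Falsum = Falsum"
| "forget (Atom P) = Atom P"
| "forget (A \<^bold>\<rightarrow> B) = (forget A \<^bold>\<rightarrow> forget B)"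
| "forget (t \<^bold>: A) = forget A"

lemma forget_fsubst [simp]: "forget (A\<langle>w/t\<rangle>) = forget A"
  by (induction A) auto

lemma forget_classical: "classical A \<Longrightarrow> forget A = A"
  by (induction A) auto

lemma eval_forget: "eval v (forget A) \<longleftrightarrow> eval (\<lambda>B. eval v (forget B)) A"
  by (induction A) auto

lemma tautology_forget: "tautology A \<Longrightarrow> tautology (forget A)"
  unfolding tautology_def by (subst eval_forget) simp

lemma se_axiom_imp_tautology_forget: "se_axiom A \<Longrightarrow> tautology (forget A)"
proof (induction rule: se_axiom.induct)
  case (CL A)
  then show ?case by (rule tautology_forget)
qed (auto simp: tautology_def)

lemma se_derivable_imp_tautology_forget: "(\<turnstile>\<^sub>S\<^sub>E A) \<Longrightarrow> tautology (forget A)"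
proof (induction rule: se_derivable.induct)
  case (ax A)
  then show ?case by (rule se_axiom_imp_tautology_forget)
qed (auto simp: tautology_def)

lemma se_derivable_iff_tautology:
  assumes "classical A"
  shows "(\<turnstile>\<^sub>S\<^sub>E A) \<longleftrightarrow> tautology A"
proof
  show "tautology A" if "\<turnstile>\<^sub>S\<^sub>E A"
    using se_derivable_imp_tautology_forget[OF that] by (simp add: forget_classical assms)
qed (auto intro: ax CL)

lemma cl_derivable_imp_tautology: "(\<turnstile>\<^sub>C\<^sub>L A) \<Longrightarrow> tautology A"
  by (induction rule: cl_derivable.induct) (auto simp: tautology_def)

lemma cl_derivable_imp_classical: "(\<turnstile>\<^sub>C\<^sub>L A) \<Longrightarrow> classical A"
  by (induction rule: cl_derivable.induct) auto

lemma cl_derivable_Imp_refl: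
  assumes "classical A"
  shows "\<turnstile>\<^sub>C\<^sub>L A \<^bold>\<rightarrow> A"
proof -
  have "\<turnstile>\<^sub>C\<^sub>L (A \<^bold>\<rightarrow> ((A \<^bold>\<rightarrow> A) \<^bold>\<rightarrow> A)) \<^bold>\<rightarrow> ((A \<^bold>\<rightarrow> (A \<^bold>\<rightarrow> A)) \<^bold>\<rightarrow> (A \<^bold>\<rightarrow> A))"
    using assms by (simp add: cl_derivable.S)
  then have "\<turnstile>\<^sub>C\<^sub>L (A \<^bold>\<rightarrow> (A \<^bold>\<rightarrow> A)) \<^bold>\<rightarrow> (A \<^bold>\<rightarrow> A)"
    by (rule cl_derivable.MP) (simp add: assms cl_derivable.K)
  then show ?thesis
    by (rule cl_derivable.MP) (simp add: assms cl_derivable.K)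
qed

inductive cl_entails :: "'p fm set \<Rightarrow> 'p fm \<Rightarrow> bool" (infix "\<tturnstile>" 20) for G where
  Assm: "A \<in> G \<Longrightarrow> classical A \<Longrightarrow> G \<tturnstile> A"
| Thm: "(\<turnstile>\<^sub>C\<^sub>L A) \<Longrightarrow> G \<tturnstile> A"
| MP: "G \<tturnstile> A \<^bold>\<rightarrow> B \<Longrightarrow> G \<tturnstile> A \<Longrightarrow> G \<tturnstile> B"

lemma cl_entails_imp_classical: "G \<tturnstile> A \<Longrightarrow> classical A"
  by (induction rule: cl_entails.induct) (auto simp: cl_derivable_imp_classical)

lemma cl_entails_empty_iff: "({} \<tturnstile> A) \<longleftrightarrow> (\<turnstile>\<^sub>C\<^sub>L A)"
proof
  show "\<turnstile>\<^sub>C\<^sub>L A" if "{} \<tturnstile> A"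
    using that by (induction rule: cl_entails.induct) (auto intro: cl_derivable.MP)
qed (rule Thm)

lemma cl_entails_mono: "G \<tturnstile> A \<Longrightarrow> G \<subseteq> H \<Longrightarrow> H \<tturnstile> A"
  by (induction rule: cl_entails.induct) (auto intro: cl_entails.intros)

lemma cl_entails_insert: "G \<tturnstile> A \<Longrightarrow> insert B G \<tturnstile> A"
  by (rule cl_entails_mono) auto

lemma cl_entails_Imp_of_consequent:
  assumes "G \<tturnstile> B" "classical A"
  shows "G \<tturnstile> A \<^bold>\<rightarrow> B"
proof (rule cl_entails.MP)
  show "G \<tturnstile> B \<^bold>\<rightarrow> (A \<^bold>\<rightarrow> B)"
    using assms by (simp add: Thm cl_derivable.K cl_entails_imp_classical)
qed (rule assms)

lemma deduction_theorem:
  assumes "insert A G \<tturnstile> B" "classical A"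
  shows "G \<tturnstile> A \<^bold>\<rightarrow> B"
  using assms
proof (induction rule: cl_entails.induct)
  case (Assm B)
  then consider "B = A" | "B \<in> G" by blast
  then show ?case
  proof cases
    assume "B = A"
    then show ?thesis using Assm.prems by (simp add: Thm cl_derivable_Imp_refl)
  next
    assume "B \<in> G"
    then show ?thesis using Assm by (simp add: cl_entails.Assm cl_entails_Imp_of_consequent)
  qed
next
  case (Thm B)
  then show ?case by (simp add: cl_entails.Thm cl_entails_Imp_of_consequent)
next
  case (MP B D)
  then have "classical B" "classical D"
    using cl_entails_imp_classical by fastforce+
  then have "G \<tturnstile> (A \<^bold>\<rightarrow> (B \<^bold>\<rightarrow> D)) \<^bold>\<rightarrow> ((A \<^bold>\<rightarrow> B) \<^bold>\<rightarrow> (A \<^bold>\<rightarrow> D))"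
    using MP.prems by (simp add: cl_entails.Thm cl_derivable.S)
  then have "G \<tturnstile> (A \<^bold>\<rightarrow> B) \<^bold>\<rightarrow> (A \<^bold>\<rightarrow> D)"
    using MP.IH(1)[OF MP.prems] by (rule cl_entails.MP)
  then show ?case
    using MP.IH(2)[OF MP.prems] by (rule cl_entails.MP)
qed

lemma cl_entails_by_contradiction:
  assumes "insert (\<^bold>\<not> A) G \<tturnstile> Falsum" "classical A"
  shows "G \<tturnstile> A"
proof (rule cl_entails.MP)
  show "G \<tturnstile> \<^bold>\<not> \<^bold>\<not> A \<^bold>\<rightarrow> A" using assms(2) by (simp add: Thm cl_derivable.DN)
  show "G \<tturnstile> \<^bold>\<not> \<^bold>\<not> A" using assms by (simp add: deduction_theorem)
qed

lemma cl_entails_by_cases: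
  assumes pos: "insert P G \<tturnstile> A" and neg: "insert (\<^bold>\<not> P) G \<tturnstile> A" and classical_P: "classical P"
  shows "G \<tturnstile> A"
proof (rule cl_entails_by_contradiction)
  let ?H = "insert (\<^bold>\<not> A) G"
  show "classical A" using pos by (rule cl_entails_imp_classical)
  then have not_A: "?H \<tturnstile> \<^bold>\<not> A" by (simp add: Assm)
  have "insert P ?H \<tturnstile> A" using pos by (rule cl_entails_mono) auto
  then have "insert P ?H \<tturnstile> Falsum" by (rule cl_entails.MP[OF cl_entails_insert[OF not_A]])
  then have not_P: "?H \<tturnstile> \<^bold>\<not> P" using classical_P by (rule deduction_theorem)
  have "?H \<tturnstile> \<^bold>\<not> P \<^bold>\<rightarrow> A" using neg classical_P by (simp add: cl_entails_insert deduction_theorem)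
  then have "?H \<tturnstile> A" using not_P by (rule cl_entails.MP)
  then show "?H \<tturnstile> Falsum" by (rule cl_entails.MP[OF not_A])
qed

lemma cl_entails_Imp_of_neg_antecedent:
  assumes "G \<tturnstile> \<^bold>\<not> A" "classical B"
  shows "G \<tturnstile> A \<^bold>\<rightarrow> B"
proof (rule deduction_theorem)
  show "classical A" using cl_entails_imp_classical[OF assms(1)] by simp
  then have "insert (\<^bold>\<not> B) (insert A G) \<tturnstile> A" by (simp add: Assm)
  moreover have "insert (\<^bold>\<not> B) (insert A G) \<tturnstile> \<^bold>\<not> A" using assms(1) by (simp add: cl_entails_insert)
  ultimately have "insert (\<^bold>\<not> B) (insert A G) \<tturnstile> Falsum" by (rule cl_entails.MP[rotated])
  then show "insert A G \<tturnstile> B" using assms(2) by (rule cl_entails_by_contradiction)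
qed

lemma cl_entails_Neg_Imp:
  assumes "G \<tturnstile> A" "G \<tturnstile> \<^bold>\<not> B"
  shows "G \<tturnstile> \<^bold>\<not> (A \<^bold>\<rightarrow> B)"
proof (rule deduction_theorem)
  show imp_classical: "classical (A \<^bold>\<rightarrow> B)"
    using assms[THEN cl_entails_imp_classical] by simp
  let ?H = "insert (A \<^bold>\<rightarrow> B) G"
  have "?H \<tturnstile> A \<^bold>\<rightarrow> B" using imp_classical by (simp add: Assm)
  then have "?H \<tturnstile> B" using cl_entails_insert[OF assms(1)] by (rule cl_entails.MP)
  then show "?H \<tturnstile> Falsum" by (rule cl_entails.MP[OF cl_entails_insert[OF assms(2)]])
qed

definition signed :: "('p fm \<Rightarrow> bool) \<Rightarrow> 'p fm \<Rightarrow> 'p fm" where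
  "signed v A = (if eval v A then A else \<^bold>\<not> A)"

lemma signed_atoms_entail_signed:
  assumes "classical A"
  shows "signed v ` Atom ` set_fm A \<tturnstile> signed v A"
  using assms
proof (induction A)
  case Falsum
  then show ?case by (simp add: signed_def Thm cl_derivable_Imp_refl)
next
  case (Atom P)
  then show ?case by (simp add: signed_def Assm)
next
  case (Imp A B)
  let ?G = "signed v ` Atom ` set_fm (A \<^bold>\<rightarrow> B)"
  have signed_A: "?G \<tturnstile> signed v A"
    using Imp by (intro cl_entails_mono[OF Imp.IH(1)]) auto
  have signed_B: "?G \<tturnstile> signed v B"
    using Imp by (intro cl_entails_mono[OF Imp.IH(2)]) auto
  consider "eval v B" | "\<not> eval v A" | "eval v A" "\<not> eval v B" by blast
  then show ?case
  proof cases
    assume "eval v B"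
    then show ?thesis using signed_B Imp.prems
      by (simp add: signed_def cl_entails_Imp_of_consequent)
  next
    assume "\<not> eval v A"
    then show ?thesis using signed_A Imp.prems
      by (simp add: signed_def cl_entails_Imp_of_neg_antecedent)
  next
    assume "eval v A" "\<not> eval v B"
    then show ?thesis using signed_A signed_B
      by (simp add: signed_def cl_entails_Neg_Imp)
  qed
qed simp

lemma signed_atoms_fun_upd:
  assumes "P \<notin> S"
  shows "signed (v(Atom P := b)) ` Atom ` insert P S =
    insert (if b then Atom P else \<^bold>\<not> Atom P) (signed v ` Atom ` S)"
proof -
  have "signed (v(Atom P := b)) ` Atom ` S = signed v ` Atom ` S"
    unfolding image_image using assms by (intro image_cong) (auto simp: signed_def)
  moreover have "signed (v(Atom P := b)) (Atom P) = (if b then Atom P else \<^bold>\<not> Atom P)"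
    by (simp add: signed_def)
  ultimately show ?thesis by (simp only: image_insert)
qed

lemma cl_entails_discharge_signed_atoms:
  assumes "finite S" "\<And>v. signed v ` Atom ` S \<union> G \<tturnstile> A"
  shows "G \<tturnstile> A"
  using assms
proof (induction S rule: finite_induct)
  case (insert P S)
  have "signed v ` Atom ` S \<union> G \<tturnstile> A" for v
  proof (rule cl_entails_by_cases)
    show "insert (Atom P) (signed v ` Atom ` S \<union> G) \<tturnstile> A"
      using insert.prems[of "v(Atom P := True)"]
      unfolding signed_atoms_fun_upd[OF insert.hyps(2)] by simp
    show "insert (\<^bold>\<not> Atom P) (signed v ` Atom ` S \<union> G) \<tturnstile> A"
      using insert.prems[of "v(Atom P := False)"]
      unfolding signed_atoms_fun_upd[OF insert.hyps(2)] by simp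
  qed simp
  then show ?case by (rule insert.IH)
qed simp

lemma finite_set_fm: "finite (set_fm A)"
  by (induction A) auto

lemma tautology_imp_cl_derivable:
  assumes "classical A" "tautology A"
  shows "\<turnstile>\<^sub>C\<^sub>L A"
proof (rule cl_entails_empty_iff[THEN iffD1], rule cl_entails_discharge_signed_atoms[OF finite_set_fm])
  show "signed v ` Atom ` set_fm A \<union> {} \<tturnstile> A" for v
    using signed_atoms_entail_signed[OF assms(1)] assms(2) by (simp add: signed_def tautology_def)
qed

lemma cl_derivable_iff_tautology: "classical A \<Longrightarrow> (\<turnstile>\<^sub>C\<^sub>L A) \<longleftrightarrow> tautology A"
  using cl_derivable_imp_tautology tautology_imp_cl_derivable by blast

theorem mainTheorem5:
  fixes A :: "'p fm"
  assumes "classical A"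
  shows "(\<turnstile>\<^sub>S\<^sub>E A) \<longleftrightarrow> (\<turnstile>\<^sub>C\<^sub>L A)"
  using assms by (simp add: se_derivable_iff_tautology cl_derivable_iff_tautology)

end
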